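(* Let $R$ be a ring and $n\ge1$. For a matrix $T=[t_{i,j}]\in\mathrm{M}_n(R)$ the following are equivalent. (1) $T$ is transitive. (2) There exists a sequence $g_i\in\mathrm{U}(R)$, $1\le i\le n$, of invertible elements such that $t_{i,j}=g_ig_j^{-1}$ for all $i,j\in\{1,\ldots,n\}$. If $h_i\in\mathrm{U}(R)$, $1\le i\le n$, is another sequence with $t_{i,j}=h_ih_j^{-1}$ for all $i,j$, then $h_i=g_ic$ (for all $i$) for some constant $c\in\mathrm{U}(R)$. (3) There exists an $n\times1$ (column) matrix $G$ with invertible entries $g_i\in\mathrm{U}(R)$, $1\le i\le n$, such that $T=G\widetilde{G}$, where $\widetilde{G}=[g_1^{-1},\ldots,g_n^{-1}]$ is a $1\times n$ (row) matrix.
   Context: A ring means a not necessarily commutative ring with identity. $\mathrm{U}(R)$ is the group of units of $R$ and $\mathrm{M}_n(R)$ the ring of $n\times n$ matrices over $R$. A matrix $T=[t_{i,j}]\in\mathrm{M}_n(R)$ is transitive if $t_{i,i}=1$ and $t_{i,j}t_{j,k}=t_{i,k}$ for all $i,j,k\in\{1,\ldots,n\}$. *)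

theory Defs
  imports "HOL-Algebra.Ring" "Jordan_Normal_Form.Matrix"
begin

text \<open>
  Rings are records satisfying the locale predicate \<^locale>\<open>ring\<close>: associative with identity,
  not necessarily commutative, the zero ring included.  The type \<^typ>\<open>'a mat\<close> serves as the
  container for matrices with entries in the carrier.  Its own product refers to type-class
  operations, so the product over a ring record is defined here.  Indices run from \<open>0\<close> to
  \<open>n - 1\<close>.
\<close>

definition matrices :: "('a, 'b) ring_scheme \<Rightarrow> nat \<Rightarrow> nat \<Rightarrow> 'a mat set" where
  "matrices R m n = {A \<in> carrier_mat m n. \<forall>i<m. \<forall>j<n. A $$ (i, j) \<in> carrier R}"

definition matrix_prod :: "('a, 'b) ring_scheme \<Rightarrow> 'a mat \<Rightarrow> 'a mat \<Rightarrow> 'a mat" where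
  "matrix_prod R A B =
     mat (dim_row A) (dim_col B)
       (\<lambda>(i, j). \<Oplus>\<^bsub>R\<^esub>k\<in>{..<dim_col A}. A $$ (i, k) \<otimes>\<^bsub>R\<^esub> B $$ (k, j))"

definition transitive_matrix :: "('a, 'b) ring_scheme \<Rightarrow> nat \<Rightarrow> 'a mat \<Rightarrow> bool" where
  "transitive_matrix R n T \<longleftrightarrow>
     (\<forall>i<n. T $$ (i, i) = \<one>\<^bsub>R\<^esub>) \<and>
     (\<forall>i<n. \<forall>j<n. \<forall>k<n. T $$ (i, j) \<otimes>\<^bsub>R\<^esub> T $$ (j, k) = T $$ (i, k))"

text \<open>The row \<open>[g\<^sub>1\<inverse>, \<dots>, g\<^sub>n\<inverse>]\<close> belonging to a column \<open>G\<close> with entries \<open>g\<^sub>i\<close>.\<close>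

definition inverse_row :: "('a, 'b) ring_scheme \<Rightarrow> 'a mat \<Rightarrow> 'a mat" where
  "inverse_row R G = mat 1 (dim_row G) (\<lambda>(i, j). inv\<^bsub>R\<^esub> (G $$ (j, 0)))"

end

theory Submission
  imports Defs
begin

text \<open>A transitive matrix is determined by its first column. From
  \<open>t_{i,0} t_{0,i} = t_{i,i} = 1\<close> and \<open>t_{0,i} t_{i,0} = t_{0,0} = 1\<close>, the
  entry \<open>g_i = t_{i,0}\<close> is a unit with inverse \<open>t_{0,i}\<close>, so
  \<open>t_{i,j} = t_{i,0} t_{0,j} = g_i g_j^{-1}\<close>. Conversely, products of such quotients
  telescope (\<open>transitive_matrix_iff_factors\<close>). Two factorizations of one matrix differ
  by a constant unit on the right (\<open>Units_factors_unique\<close>), so (2) amounts to the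
  existence of a factorization. Condition (3) is the same factorization in matrix form, since each
  entry of a column times a row is a single product
  (\<open>factors_iff_column_times_row\<close>).\<close>

context monoid
begin

text \<open>Fixing one index \<open>k\<close> and solving
  \<open>g i \<otimes> inv (g k) = h i \<otimes> inv (h k)\<close> for \<open>h i\<close> gives the
  constant \<open>inv (g k) \<otimes> h k\<close>, which does not depend on \<open>i\<close>. Only
  multiplication is involved, so a monoid suffices.\<close>

lemma Units_factors_unique:
  assumes g: "\<And>i. i \<in> I \<Longrightarrow> g i \<in> Units G"
    and h: "\<And>i. i \<in> I \<Longrightarrow> h i \<in> Units G"
    and eq: "\<And>i j. i \<in> I \<Longrightarrow> j \<in> I \<Longrightarrow> g i \<otimes> inv (g j) = h i \<otimes> inv (h j)"
  shows "\<exists>c\<in>Units G. \<forall>i\<in>I. h i = g i \<otimes> c"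
proof (cases "I = {}")
  case False
  then obtain k where k: "k \<in> I"
    by blast
  show ?thesis
  proof (intro bexI ballI)
    fix i assume i: "i \<in> I"
    \<comment> \<open>The hypothesis at \<open>(i, k)\<close>, multiplied on the right by
      \<open>h k\<close>.\<close>
    have "g i \<otimes> (inv (g k) \<otimes> h k) = h i \<otimes> inv (h k) \<otimes> h k"
      using g[OF i] g[OF k] h[OF k] by (simp add: eq[OF i k, symmetric] m_assoc Units_closed)
    also have "\<dots> = h i"
      using h[OF i] h[OF k] by (simp add: m_assoc Units_closed)
    finally show "h i = g i \<otimes> (inv (g k) \<otimes> h k)" ..
  qed (use g h k in auto)
qed auto

lemma Units_factors_transitive:
  assumes "x \<in> Units G" "y \<in> Units G" "z \<in> Units G"
  shows "(x \<otimes> inv y) \<otimes> (y \<otimes> inv z) = x \<otimes> inv z"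
proof -
  \<comment> \<open>Rebracketing puts \<open>inv y \<otimes> y\<close> side by side, ready to
    cancel.\<close>
  have "(x \<otimes> inv y) \<otimes> (y \<otimes> inv z) = x \<otimes> (inv y \<otimes> y \<otimes> inv z)"
    using assms by (simp only: m_assoc Units_closed Units_inv_closed m_closed)
  then show ?thesis
    using assms by simp
qed

end

context ring
begin

text \<open>The witness is column 0 of \<open>T\<close>, and row 0 holds the inverses. The index 0
  is legitimate as soon as some \<open>i < n\<close> is given.\<close>

lemma transitive_matrix_iff_factors:
  assumes T: "T \<in> matrices R n n"
  shows "transitive_matrix R n T \<longleftrightarrow>
    (\<exists>g. (\<forall>i<n. g i \<in> Units R) \<and> (\<forall>i<n. \<forall>j<n. T $$ (i, j) = g i \<otimes> inv (g j)))"
    (is "_ \<longleftrightarrow> ?factors")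
proof
  assume trans: "transitive_matrix R n T"
  have closed: "T $$ (i, j) \<in> carrier R" if "i < n" "j < n" for i j
    using T that by (simp add: matrices_def)
  have mult: "T $$ (i, j) \<otimes> T $$ (j, k) = T $$ (i, k)" if "i < n" "j < n" "k < n" for i j k
    using trans that by (simp add: transitive_matrix_def)
  have units: "T $$ (i, 0) \<in> Units R" and inverse: "inv (T $$ (i, 0)) = T $$ (0, i)"
    if "i < n" for i
  proof -
    \<comment> \<open>Going from \<open>i\<close> to 0 and back, and from 0 to \<open>i\<close> and
      back; without commutativity both products are checked.\<close>
    have "T $$ (i, 0) \<otimes> T $$ (0, i) = \<one>" "T $$ (0, i) \<otimes> T $$ (i, 0) = \<one>"
      using trans that by (simp_all add: transitive_matrix_def)
    then show "T $$ (i, 0) \<in> Units R" "inv (T $$ (i, 0)) = T $$ (0, i)"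
      using closed that by (auto simp: Units_def intro!: inv_char)
  qed
  \<comment> \<open>After replacing the inverse by \<open>T $$ (0, j)\<close>, this is transitivity
    through the middle index 0.\<close>
  have "T $$ (i, j) = T $$ (i, 0) \<otimes> inv (T $$ (j, 0))" if "i < n" "j < n" for i j
    using that by (simp add: inverse mult)
  then show ?factors
    using units by (intro exI[of _ "\<lambda>i. T $$ (i, 0)"]) blast
next
  assume ?factors
  then obtain g where "\<And>i. i < n \<Longrightarrow> g i \<in> Units R"
    and "\<And>i j. i < n \<Longrightarrow> j < n \<Longrightarrow> T $$ (i, j) = g i \<otimes> inv (g j)"
    by blast
  then show "transitive_matrix R n T"
    by (simp add: transitive_matrix_def Units_factors_transitive)
qed

text \<open>The inner dimension is 1, so each sum in the product has one summand.\<close>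

lemma column_times_inverse_row:
  assumes G: "G \<in> matrices R m 1" and units: "\<And>i. i < m \<Longrightarrow> G $$ (i, 0) \<in> Units R"
  shows "matrix_prod R G (inverse_row R G) =
    mat m m (\<lambda>(i, j). G $$ (i, 0) \<otimes> inv (G $$ (j, 0)))"
proof (rule eq_matI)
  have dims: "dim_row G = m" "dim_col G = 1"
    using G by (auto simp: matrices_def)
  fix i j
  assume "i < dim_row (mat m m (\<lambda>(i, j). G $$ (i, 0) \<otimes> inv (G $$ (j, 0))))"
    and "j < dim_col (mat m m (\<lambda>(i, j). G $$ (i, 0) \<otimes> inv (G $$ (j, 0))))"
  then have ij: "i < m" "j < m"
    by simp_all
  then have "matrix_prod R G (inverse_row R G) $$ (i, j) =
      (\<Oplus>k\<in>{0}. G $$ (i, k) \<otimes> inverse_row R G $$ (k, j))"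
    by (simp add: matrix_prod_def dims inverse_row_def lessThan_Suc)
  \<comment> \<open>A sum over a singleton equals its term once that term lies in the carrier; the
    unit hypothesis ensures this, inverses included.\<close>
  also have "\<dots> = G $$ (i, 0) \<otimes> inv (G $$ (j, 0))"
    using ij units by (simp add: inverse_row_def dims Units_closed)
  finally show "matrix_prod R G (inverse_row R G) $$ (i, j) =
      mat m m (\<lambda>(i, j). G $$ (i, 0) \<otimes> inv (G $$ (j, 0))) $$ (i, j)"
    using ij by simp
qed (use G in \<open>auto simp: matrix_prod_def inverse_row_def matrices_def\<close>)

text \<open>A family \<open>g\<close> and a column \<open>G\<close> carry the same data:
  \<open>g\<close> is stored as an \<open>n\<close> by 1 matrix, or read off from its
  entries.\<close>

lemma factors_iff_column_times_row:
  assumes T: "T \<in> matrices R n n"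
  shows "(\<exists>g. (\<forall>i<n. g i \<in> Units R) \<and> (\<forall>i<n. \<forall>j<n. T $$ (i, j) = g i \<otimes> inv (g j))) \<longleftrightarrow>
    (\<exists>G\<in>matrices R n 1. (\<forall>i<n. G $$ (i, 0) \<in> Units R) \<and>
      T = matrix_prod R G (inverse_row R G))"
    (is "?factors \<longleftrightarrow> ?column")
proof
  assume ?factors
  then obtain g where units: "\<And>i. i < n \<Longrightarrow> g i \<in> Units R"
    and T_eq: "\<And>i j. i < n \<Longrightarrow> j < n \<Longrightarrow> T $$ (i, j) = g i \<otimes> inv (g j)"
    by blast
  define G where "G = mat n 1 (\<lambda>(i, _). g i)"
  have entry: "G $$ (i, 0) = g i" if "i < n" for i
    using that by (simp add: G_def)
  have G: "G \<in> matrices R n 1"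
    using units by (auto simp: matrices_def G_def Units_closed)
  have "T = mat n n (\<lambda>(i, j). G $$ (i, 0) \<otimes> inv (G $$ (j, 0)))"
    using T by (intro eq_matI) (auto simp: matrices_def T_eq entry)
  then have "T = matrix_prod R G (inverse_row R G)"
    using column_times_inverse_row[OF G] units by (simp add: entry)
  then show ?column
    using G units by (intro bexI[of _ G]) (simp_all add: entry)
next
  assume ?column
  then obtain G where G: "G \<in> matrices R n 1" "\<And>i. i < n \<Longrightarrow> G $$ (i, 0) \<in> Units R"
    and T_eq: "T = matrix_prod R G (inverse_row R G)"
    by blast
  then show ?factors
    by (intro exI[of _ "\<lambda>i. G $$ (i, 0)"]) (simp add: column_times_inverse_row)
qed

end

theorem proposition2p1:
  fixes R :: "('a, 'b) ring_scheme" (structure)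
    and n :: nat
    and T :: "'a mat"
  assumes "ring R"
    and "n \<ge> 1"
    and "T \<in> matrices R n n"
  defines "cond1 \<equiv> transitive_matrix R n T"
    and "cond2 \<equiv>
      (\<exists>g :: nat \<Rightarrow> 'a.
         (\<forall>i<n. g i \<in> Units R) \<and>
         (\<forall>i<n. \<forall>j<n. T $$ (i, j) = g i \<otimes> inv (g j)) \<and>
         (\<forall>h :: nat \<Rightarrow> 'a.
            (\<forall>i<n. h i \<in> Units R) \<and>
            (\<forall>i<n. \<forall>j<n. T $$ (i, j) = h i \<otimes> inv (h j)) \<longrightarrow>
            (\<exists>c\<in>Units R. \<forall>i<n. h i = g i \<otimes> c)))"
    and "cond3 \<equiv>
      (\<exists>G \<in> matrices R n 1.
         (\<forall>i<n. G $$ (i, 0) \<in> Units R) \<and>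
         T = matrix_prod R G (inverse_row R G))"
  shows "(cond1 \<longleftrightarrow> cond2) \<and> (cond2 \<longleftrightarrow> cond3)"
proof -
  interpret ring R by fact
  let ?factors = "\<lambda>g. (\<forall>i<n. g i \<in> Units R) \<and> (\<forall>i<n. \<forall>j<n. T $$ (i, j) = g i \<otimes> inv (g j))"
  have unique: "\<exists>c\<in>Units R. \<forall>i<n. h i = g i \<otimes> c" if "?factors g" "?factors h" for g h
    using Units_factors_unique[of "{..<n}" g h] that by auto
  \<comment> \<open>\<open>unique\<close> supplies the last clause of \<open>cond2\<close> for every
    factorization \<open>g\<close>, leaving the existence statement that both equivalence lemmas
    share.\<close>
  have "cond2 \<longleftrightarrow> (\<exists>g. ?factors g)"
    unfolding cond2_def using unique by blast
  then show ?thesis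
    unfolding cond1_def cond3_def
    using transitive_matrix_iff_factors[OF \<open>T \<in> matrices R n n\<close>]
      factors_iff_column_times_row[OF \<open>T \<in> matrices R n n\<close>] by simp
qed

end
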